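(* Let $L_n=P_n\square P_2$ be the ladder graph on $2n$ vertices, with its standard plane embedding (outer cycle $v_1,\dots,v_n,u_n,\dots,u_1$ and inner faces the quadrangles $v_iv_{i+1}u_{i+1}u_i$). Then $\pi_{fl}(L_n)\le 8$.
   Context: A sequence $r_1\dots r_{2n}$ is a repetition if $r_i=r_{n+i}$ for all $i\le n$. In a plane graph $G$, a facial path is a path whose vertices and edges are consecutive on the boundary walk of some face of $G$. A vertex colouring is facial non-repetitive if no facial path on vertices $v_1,\dots,v_{2n}$ ($n\ge1$) has colour sequence that is a repetition. $\pi_{fl}(G)$ is the minimum $l$ such that for every assignment of lists $L(v)\subseteq\mathbb{Z}_+$ with $|L(v)|\ge l$ there is a facial non-repetitive colouring $\varphi$ with $\varphi(v)\in L(v)$ for every vertex $v$. *)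

theory Defs
  imports
    "Graph_Theory.Graph_Theory"
    "HOL-Combinatorics.Cycles"
    "HOL-Library.Extended_Nat"
begin

section \<open>Plane graphs\<close>

text \<open>
  Simple graphs are symmetric loop-free pair digraphs, so that every edge gives two opposite
  arcs. A plane graph is encoded by its rotation system: \<open>R x\<close> lists the neighbours of
  \<open>x\<close> in their clockwise cyclic order around \<open>x\<close>. A boundary walk of a face that
  has reached \<open>y\<close> from \<open>x\<close> leaves \<open>y\<close> along the edge following
  \<open>yx\<close> in the clockwise order around \<open>y\<close>, so it keeps its face on the left.
  Facial walks are thus the orbits of \<open>next_arc\<close> on the arcs, and the embedding described
  by \<open>R\<close> is one in the plane iff Euler's formula holds.
\<close>

fun next_arc :: "('a \<Rightarrow> 'a list) \<Rightarrow> 'a \<times> 'a \<Rightarrow> 'a \<times> 'a" where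
  "next_arc R (x, y) = (y, cycle_of_list (R y) x)"

definition facial_walks :: "'a pair_pre_digraph \<Rightarrow> ('a \<Rightarrow> 'a list) \<Rightarrow> ('a \<times> 'a) set set" where
  "facial_walks G R = orbit (next_arc R) ` parcs G"

definition rotation_system :: "'a pair_pre_digraph \<Rightarrow> ('a \<Rightarrow> 'a list) \<Rightarrow> bool" where
  "rotation_system G R \<longleftrightarrow>
     (\<forall>x \<in> pverts G. distinct (R x) \<and> set (R x) = {y. (x, y) \<in> parcs G})"

text \<open>
  Euler's formula is written with twice the number of edges, i.e. the number of arcs. The
  one-vertex graph is treated separately because its only face has no arc on its boundary.
\<close>

definition connected_plane_graph :: "'a pair_pre_digraph \<Rightarrow> ('a \<Rightarrow> 'a list) \<Rightarrow> bool" where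
  "connected_plane_graph G R \<longleftrightarrow>
     pair_graph G \<and> connected G \<and> rotation_system G R \<and>
     (parcs G = {} \<or> 2 * card (pverts G) + 2 * card (facial_walks G R) = card (parcs G) + 4)"

text \<open>
  A facial path is given by its vertex sequence, in either of its two directions. The arc from
  the last vertex of the segment to the next one on the boundary walk is not part of the path.
\<close>

definition boundary_segment ::
  "'a pair_pre_digraph \<Rightarrow> ('a \<Rightarrow> 'a list) \<Rightarrow> 'a list \<Rightarrow> bool" where
  "boundary_segment G R p \<longleftrightarrow>
     (\<exists>e \<in> parcs G. p = map (\<lambda>k. fst ((next_arc R ^^ k) e)) [0..<length p])"

definition facial_path :: "'a pair_pre_digraph \<Rightarrow> ('a \<Rightarrow> 'a list) \<Rightarrow> 'a list \<Rightarrow> bool" where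
  "facial_path G R p \<longleftrightarrow> p \<noteq> [] \<and> distinct p \<and>
     (boundary_segment G R p \<or> boundary_segment G R (rev p) \<or> (\<exists>x \<in> pverts G. p = [x]))"


section \<open>Facial non-repetitive list colourings\<close>

definition repetition :: "'c list \<Rightarrow> bool" where
  "repetition r \<longleftrightarrow> (\<exists>n \<ge> 1. length r = 2 * n \<and> (\<forall>i < n. r ! i = r ! (n + i)))"

definition facial_nonrepetitive ::
  "'a pair_pre_digraph \<Rightarrow> ('a \<Rightarrow> 'a list) \<Rightarrow> ('a \<Rightarrow> 'c) \<Rightarrow> bool" where
  "facial_nonrepetitive G R \<phi> \<longleftrightarrow> (\<forall>p. facial_path G R p \<longrightarrow> \<not> repetition (map \<phi> p))"

text \<open>Lists may be infinite, where \<open>card\<close> would be 0.\<close>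

definition facial_choosable :: "'a pair_pre_digraph \<Rightarrow> ('a \<Rightarrow> 'a list) \<Rightarrow> nat \<Rightarrow> bool" where
  "facial_choosable G R l \<longleftrightarrow>
     (\<forall>L :: 'a \<Rightarrow> nat set.
        (\<forall>x \<in> pverts G. L x \<subseteq> {1..} \<and> (infinite (L x) \<or> l \<le> card (L x))) \<longrightarrow>
        (\<exists>\<phi>. facial_nonrepetitive G R \<phi> \<and> (\<forall>x \<in> pverts G. \<phi> x \<in> L x)))"

text \<open>The minimum is taken in \<^typ>\<open>enat\<close>, so that it is infinite if there is no such l.\<close>

definition facial_thue_choice_number ::
  "'a pair_pre_digraph \<Rightarrow> ('a \<Rightarrow> 'a list) \<Rightarrow> enat" where
  "facial_thue_choice_number G R = (INF l \<in> {l. facial_choosable G R l}. enat l)"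


section \<open>Ladders\<close>

definition path_graph :: "nat \<Rightarrow> nat pair_pre_digraph" where
  "path_graph n = \<lparr> pverts = {1..n},
     parcs = {(i, j). i \<in> {1..n} \<and> j \<in> {1..n} \<and> (j = i + 1 \<or> i = j + 1)} \<rparr>"

definition cartesian_product ::
  "'a pair_pre_digraph \<Rightarrow> 'b pair_pre_digraph \<Rightarrow> ('a \<times> 'b) pair_pre_digraph" where
  "cartesian_product G H = \<lparr> pverts = pverts G \<times> pverts H,
     parcs = {((a, b), (c, d)).
       a = c \<and> a \<in> pverts G \<and> (b, d) \<in> parcs H \<or>
       (a, c) \<in> parcs G \<and> b = d \<and> b \<in> pverts H} \<rparr>"

definition ladder :: "nat \<Rightarrow> (nat \<times> nat) pair_pre_digraph" where
  "ladder n = cartesian_product (path_graph n) (path_graph 2)"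

abbreviation vv :: "nat \<Rightarrow> nat \<times> nat" where "vv i \<equiv> (i, 1)"
abbreviation uu :: "nat \<Rightarrow> nat \<times> nat" where "uu i \<equiv> (i, 2)"

text \<open>
  The ladder is drawn with \<open>vv 1, \<dots>, vv n\<close> from left to right in the upper row and
  \<open>uu i\<close> below \<open>vv i\<close>. At the ends of the ladder the missing neighbours, among them
  those with index \<open>1 - 1 = 0\<close>, are filtered out.
\<close>

fun ladder_rotation :: "nat \<Rightarrow> nat \<times> nat \<Rightarrow> (nat \<times> nat) list" where
  "ladder_rotation n (i, j) = filter (\<lambda>y. y \<in> pverts (ladder n))
     (if j = 1 then [vv (i - 1), vv (i + 1), uu i] else [uu (i - 1), vv i, uu (i + 1)])"


subsection \<open>The faces of the ladder\<close>

definition cycle_arcs :: "'a list \<Rightarrow> ('a \<times> 'a) set" where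
  "cycle_arcs xs = set (zip xs (rotate1 xs))"

definition outer_cycle :: "nat \<Rightarrow> (nat \<times> nat) list" where
  "outer_cycle n = map vv [1..<n + 1] @ rev (map uu [1..<n + 1])"

definition quadrangle :: "nat \<Rightarrow> (nat \<times> nat) list" where
  "quadrangle i = [vv i, uu i, uu (i + 1), vv (i + 1)]"

text \<open>
  The rotation system above is the standard embedding: it is planar, and its faces are the outer
  cycle and the quadrangles.
\<close>

lemma ladder_pverts: "pverts (ladder n) = {1..n} \<times> {1, 2}"
  by (auto simp: ladder_def cartesian_product_def path_graph_def)

lemma ladder_parcs:
  "parcs (ladder n) =
     (\<lambda>i. (vv i, vv (i + 1))) ` {1..<n} \<union> (\<lambda>i. (vv (i + 1), vv i)) ` {1..<n} \<union>
     (\<lambda>i. (uu i, uu (i + 1))) ` {1..<n} \<union> (\<lambda>i. (uu (i + 1), uu i)) ` {1..<n} \<union>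
     (\<lambda>i. (vv i, uu i)) ` {1..n} \<union> (\<lambda>i. (uu i, vv i)) ` {1..n}"
  by (auto simp: ladder_def cartesian_product_def path_graph_def image_iff)

lemma card_ladder_parcs:
  assumes "n \<ge> 1"
  shows "card (parcs (ladder n)) = 6 * n - 4"
proof -
  define A where "A = (\<lambda>i::nat. (vv i, vv (i + 1))) ` {1..<n}"
  define B where "B = (\<lambda>i::nat. (vv (i + 1), vv i)) ` {1..<n}"
  define C where "C = (\<lambda>i::nat. (uu i, uu (i + 1))) ` {1..<n}"
  define D where "D = (\<lambda>i::nat. (uu (i + 1), uu i)) ` {1..<n}"
  define E where "E = (\<lambda>i::nat. (vv i, uu i)) ` {1..n}"
  define F where "F = (\<lambda>i::nat. (uu i, vv i)) ` {1..n}"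
  define kind :: "(nat \<times> nat) \<times> (nat \<times> nat) \<Rightarrow> nat \<times> nat \<times> bool"
    where "kind e = (snd (fst e), snd (snd e), fst (fst e) < fst (snd e))" for e
  have kind: "e \<in> A \<Longrightarrow> kind e = (1, 1, True)" "e \<in> B \<Longrightarrow> kind e = (1, 1, False)"
    "e \<in> C \<Longrightarrow> kind e = (2, 2, True)" "e \<in> D \<Longrightarrow> kind e = (2, 2, False)"
    "e \<in> E \<Longrightarrow> kind e = (1, 2, False)" "e \<in> F \<Longrightarrow> kind e = (2, 1, False)" for e
    unfolding A_def B_def C_def D_def E_def F_def kind_def by force+
  have "card A = n - 1" "card B = n - 1" "card C = n - 1" "card D = n - 1" "card E = n" "card F = n"
    unfolding A_def B_def C_def D_def E_def F_def
    by (simp_all add: card_image inj_on_def)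
  moreover have "finite A" "finite B" "finite C" "finite D" "finite E" "finite F"
    unfolding A_def B_def C_def D_def E_def F_def by simp_all
  moreover have "A \<inter> B = {}" "(A \<union> B) \<inter> C = {}" "(A \<union> B \<union> C) \<inter> D = {}"
    "(A \<union> B \<union> C \<union> D) \<inter> E = {}" "(A \<union> B \<union> C \<union> D \<union> E) \<inter> F = {}"
    unfolding disjoint_iff by (force dest: kind)+
  ultimately have "card (A \<union> B \<union> C \<union> D \<union> E \<union> F) = (n - 1) + (n - 1) + (n - 1) + (n - 1) + n + n"
    by (simp only: card_Un_disjoint finite_Un simp_thms)
  then show ?thesis
    using assms unfolding ladder_parcs A_def B_def C_def D_def E_def F_def by simp
qed

lemma ladder_rotation_system: "rotation_system (ladder n) (ladder_rotation n)"
  unfolding rotation_system_def ladder_parcs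
  by (auto simp: ladder_pverts image_iff)

lemma ladder_pair_graph: "pair_graph (ladder n)"
proof
  show "symmetric (with_proj (ladder n))"
    unfolding symmetric_def sym_def by (auto simp: ladder_parcs)
qed (auto simp: ladder_pverts ladder_parcs)

lemma ladder_connected:
  assumes "n \<ge> 1"
  shows "connected (with_proj (ladder n))"
proof -
  interpret pair_graph "ladder n" by (rule ladder_pair_graph)
  let ?G = "with_proj (ladder n)"
  have base: "vv 1 \<rightarrow>\<^sup>*\<^bsub>?G\<^esub> vv i" if "1 \<le> i" "i \<le> n" for i
    using that
  proof (induction i rule: nat_induct_at_least)
    case base
    then show ?case by (simp add: ladder_pverts)
  next
    case (Suc i)
    then have "(vv i, vv (Suc i)) \<in> parcs (ladder n)"
      by (auto simp: ladder_parcs image_iff)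
    with Suc show ?case by (auto intro: reachable_adj_trans)
  qed
  have "vv 1 \<rightarrow>\<^sup>*\<^bsub>?G\<^esub> uu i" if "1 \<le> i" "i \<le> n" for i
  proof -
    have "(vv i, uu i) \<in> parcs (ladder n)"
      using that by (auto simp: ladder_parcs image_iff)
    with base[OF that] show ?thesis by (auto intro: reachable_adj_trans)
  qed
  with base have "vv 1 \<rightarrow>\<^sup>*\<^bsub>?G\<^esub> x" if "x \<in> pverts (ladder n)" for x
    using that by (auto simp: ladder_pverts)
  moreover have "x \<rightarrow>\<^sup>*\<^bsub>?G\<^esub> vv 1" if "vv 1 \<rightarrow>\<^sup>*\<^bsub>?G\<^esub> x" for x
    using that symmetric_reachable[OF sym_arcs] by blast
  ultimately have "x \<rightarrow>\<^sup>*\<^bsub>?G\<^esub> y" if "x \<in> pverts (ladder n)" "y \<in> pverts (ladder n)" for x y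
    using that by (meson reachable_trans)
  moreover have "(parcs (ladder n))\<^sup>s = parcs (ladder n)"
    using sym_arcs by (auto simp: symcl_def symmetric_def sym_def)
  ultimately show ?thesis
    using assms by (simp add: connected_conv reachable_def ladder_pverts)
qed

lemma orbit_eq_set_list:
  assumes "xs \<noteq> []" "map f xs = rotate1 xs" "x \<in> set xs"
  shows "orbit f x = set xs"
proof -
  have step: "f (xs ! i) = xs ! (Suc i mod length xs)" if "i < length xs" for i
    using that assms(2) by (metis nth_map nth_rotate1)
  obtain i where i: "i < length xs" "x = xs ! i"
    using assms(3) by (auto simp: in_set_conv_nth)
  have iter: "(f ^^ k) x = xs ! ((i + k) mod length xs)" for k
  proof (induction k)
    case (Suc k)
    have "(i + k) mod length xs < length xs" using i by (intro mod_less_divisor) auto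
    from step[OF this] Suc show ?case by (simp add: mod_Suc_eq)
  qed (use i in simp)
  show ?thesis
  proof
    show "orbit f x \<subseteq> set xs"
      using i(1) by (auto simp: orbit_altdef iter intro!: nth_mem mod_less_divisor)
    show "set xs \<subseteq> orbit f x"
    proof
      fix y assume "y \<in> set xs"
      then obtain j where j: "j < length xs" "y = xs ! j" by (auto simp: in_set_conv_nth)
      have "(i + (j + length xs - i)) mod length xs = j" using i j by simp
      then have "y = (f ^^ (j + length xs - i)) x" unfolding iter j(2) by simp
      moreover have "0 < j + length xs - i" using i by simp
      ultimately show "y \<in> orbit f x" by (auto simp: orbit_altdef)
    qed
  qed
qed

lemma orbit_next_arc_cycle:
  assumes "length xs \<ge> 1"
    and step: "\<And>i. i < length xs \<Longrightarrow>
      cycle_of_list (R (xs ! (Suc i mod length xs))) (xs ! i) = xs ! (Suc (Suc i) mod length xs)"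
    and "e \<in> cycle_arcs xs"
  shows "orbit (next_arc R) e = cycle_arcs xs"
proof -
  have "map (next_arc R) (zip xs (rotate1 xs)) = rotate1 (zip xs (rotate1 xs))"
  proof (rule nth_equalityI)
    fix i assume "i < length (map (next_arc R) (zip xs (rotate1 xs)))"
    then have i: "i < length xs" "Suc i mod length xs < length xs"
      by (auto intro: mod_less_divisor)
    with step[OF i(1)] show "map (next_arc R) (zip xs (rotate1 xs)) ! i = rotate1 (zip xs (rotate1 xs)) ! i"
      by (simp add: nth_rotate1 mod_Suc_eq del: length_greater_0_conv)
  qed simp
  then show ?thesis
    using assms(1,3) unfolding cycle_arcs_def by (intro orbit_eq_set_list) auto
qed

lemma ladder_turn_vv:
  assumes "1 \<le> i" "i \<le> n"
  shows
    "1 < i \<Longrightarrow> i < n \<Longrightarrow> cycle_of_list (ladder_rotation n (vv i)) (vv (i - 1)) = vv (i + 1)"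
    "1 < i \<Longrightarrow> i = n \<Longrightarrow> cycle_of_list (ladder_rotation n (vv i)) (vv (i - 1)) = uu i"
    "1 < i \<Longrightarrow> cycle_of_list (ladder_rotation n (vv i)) (uu i) = vv (i - 1)"
    "i = 1 \<Longrightarrow> 1 < n \<Longrightarrow> cycle_of_list (ladder_rotation n (vv i)) (uu i) = vv (i + 1)"
    "i = 1 \<Longrightarrow> n = 1 \<Longrightarrow> cycle_of_list (ladder_rotation n (vv i)) (uu i) = uu i"
    "i < n \<Longrightarrow> cycle_of_list (ladder_rotation n (vv i)) (vv (i + 1)) = uu i"
  using assms by (auto simp: ladder_pverts transpose_def)

lemma ladder_turn_uu:
  assumes "1 \<le> i" "i \<le> n"
  shows
    "1 < i \<Longrightarrow> cycle_of_list (ladder_rotation n (uu i)) (uu (i - 1)) = vv i"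
    "i < n \<Longrightarrow> cycle_of_list (ladder_rotation n (uu i)) (vv i) = uu (i + 1)"
    "1 < i \<Longrightarrow> i = n \<Longrightarrow> cycle_of_list (ladder_rotation n (uu i)) (vv i) = uu (i - 1)"
    "i = 1 \<Longrightarrow> n = 1 \<Longrightarrow> cycle_of_list (ladder_rotation n (uu i)) (vv i) = vv i"
    "1 < i \<Longrightarrow> i < n \<Longrightarrow> cycle_of_list (ladder_rotation n (uu i)) (uu (i + 1)) = uu (i - 1)"
    "i = 1 \<Longrightarrow> i < n \<Longrightarrow> cycle_of_list (ladder_rotation n (uu i)) (uu (i + 1)) = vv i"
  using assms by (auto simp: ladder_pverts transpose_def)

lemma quadrangle_orbit:
  assumes "1 \<le> i" "i < n" "e \<in> cycle_arcs (quadrangle i)"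
  shows "orbit (next_arc (ladder_rotation n)) e = cycle_arcs (quadrangle i)"
proof (rule orbit_next_arc_cycle[OF _ _ assms(3)])
  have turn: "cycle_of_list (ladder_rotation n (uu i)) (vv i) = uu (i + 1)"
    "cycle_of_list (ladder_rotation n (uu (i + 1))) (uu i) = vv (i + 1)"
    "cycle_of_list (ladder_rotation n (vv (i + 1))) (uu (i + 1)) = vv i"
    "cycle_of_list (ladder_rotation n (vv i)) (vv (i + 1)) = uu i"
    using ladder_turn_uu(2)[of i n] ladder_turn_uu(1)[of "i + 1" n]
      ladder_turn_vv(3)[of "i + 1" n] ladder_turn_vv(6)[of i n] assms(1,2)
    by (simp_all del: ladder_rotation.simps)
  fix k assume "k < length (quadrangle i)"
  then have "k < 4" by (simp add: quadrangle_def)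
  then consider "k = 0" | "k = 1" | "k = 2" | "k = 3" by linarith
  then show "cycle_of_list (ladder_rotation n (quadrangle i ! (Suc k mod length (quadrangle i))))
      (quadrangle i ! k) = quadrangle i ! (Suc (Suc k) mod length (quadrangle i))"
    using turn by cases (simp_all add: quadrangle_def del: ladder_rotation.simps)
qed (simp add: quadrangle_def)

lemma nth_outer_cycle:
  assumes "k < 2 * n"
  shows "outer_cycle n ! k = (if k < n then vv (k + 1) else uu (2 * n - k))"
  using assms by (auto simp: outer_cycle_def nth_append rev_nth simp del: upt_Suc)

lemma length_outer_cycle [simp]: "length (outer_cycle n) = 2 * n"
  by (simp add: outer_cycle_def)

lemma outer_cycle_orbit:
  assumes "n \<ge> 1" "e \<in> cycle_arcs (outer_cycle n)"
  shows "orbit (next_arc (ladder_rotation n)) e = cycle_arcs (outer_cycle n)"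
proof (rule orbit_next_arc_cycle[OF _ _ assms(2)])
  fix k assume "k < length (outer_cycle n)"
  then have k: "k < 2 * n" by simp
  define x where "x k = (if k < n then vv (k + 1) else uu (2 * n - k))" for k
  have x: "outer_cycle n ! (j mod (2 * n)) = x (j mod (2 * n))" for j
    using assms(1) by (subst nth_outer_cycle) (auto simp: x_def)
  have "cycle_of_list (ladder_rotation n (x (Suc k mod (2 * n)))) (x (k mod (2 * n)))
    = x (Suc (Suc k) mod (2 * n))"
  proof (cases "n = 1")
    case True
    with k consider "k = 0" | "k = 1" by force
    then show ?thesis using True ladder_turn_vv(5)[of 1 n] ladder_turn_uu(4)[of 1 n]
      by cases (simp_all add: x_def mod_Suc numeral_eq_Suc del: ladder_rotation.simps)
  next
    case False
    with assms(1) have n: "n \<ge> 2" by simp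
    with k consider "k + 2 < n" | "k + 2 = n" | "k + 1 = n" | "n \<le> k" "k + 2 < 2 * n"
      | "k + 2 = 2 * n" | "k + 1 = 2 * n" by linarith
    then show ?thesis
    proof cases
      case 1
      then show ?thesis using ladder_turn_vv(1)[of "k + 2" n]
        by (simp add: x_def del: ladder_rotation.simps)
    next
      case 2
      then show ?thesis using ladder_turn_vv(2)[of "k + 2" n] n
        by (auto simp add: x_def simp del: ladder_rotation.simps)
    next
      case 3
      then show ?thesis using ladder_turn_uu(3)[of n n] n
        by (auto simp add: x_def simp del: ladder_rotation.simps)
    next
      case 4
      then show ?thesis using ladder_turn_uu(5)[of "2 * n - k - 1" n] n
        by (auto simp add: x_def Suc_diff_Suc numeral_eq_Suc simp del: ladder_rotation.simps)
    next
      case 5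
      then have "k mod (2 * n) = 2 * n - 2" "Suc k mod (2 * n) = 2 * n - 1"
        "Suc (Suc k) mod (2 * n) = 0" by auto
      then show ?thesis using ladder_turn_uu(6)[of 1 n] n
        by (auto simp add: x_def numeral_eq_Suc simp del: ladder_rotation.simps)
    next
      case 6
      then have "k mod (2 * n) = 2 * n - 1" "Suc k mod (2 * n) = 0"
        "Suc (Suc k) mod (2 * n) = 1" using n by (auto simp: mod_Suc)
      then show ?thesis using ladder_turn_vv(4)[of 1 n] n
        by (auto simp add: x_def numeral_eq_Suc simp del: ladder_rotation.simps)
    qed
  qed
  with k show "cycle_of_list (ladder_rotation n (outer_cycle n ! (Suc k mod length (outer_cycle n))))
      (outer_cycle n ! k) = outer_cycle n ! (Suc (Suc k) mod length (outer_cycle n))"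
    using x[of k] by (simp add: x del: ladder_rotation.simps)
qed (use assms in simp)

lemma cycle_arcs_outer_cycle:
  assumes "n \<ge> 1"
  shows "cycle_arcs (outer_cycle n) =
     (\<lambda>i. (vv i, vv (i + 1))) ` {1..<n} \<union> (\<lambda>i. (uu (i + 1), uu i)) ` {1..<n} \<union>
     {(vv n, uu n), (uu 1, vv 1)}" (is "_ = ?A")
proof -
  let ?o = "outer_cycle n"
  define x where "x k = (if k < n then vv (k + 1) else uu (2 * n - k))" for k
  have o: "?o ! k = x k" if "k < 2 * n" for k
    using nth_outer_cycle[OF that] by (simp add: x_def)
  have "cycle_arcs ?o = (\<lambda>k. (?o ! k, ?o ! (Suc k mod (2 * n)))) ` {0..<2 * n}"
    unfolding cycle_arcs_def set_zip by (auto simp: nth_rotate1)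
  also have "\<dots> = (\<lambda>k. (x k, x (Suc k mod (2 * n)))) ` {0..<2 * n}"
    using assms by (intro image_cong) (auto simp: o)
  also have "{0..<2 * n} = {0..<n - 1} \<union> {n..<2 * n - 1} \<union> {n - 1, 2 * n - 1}"
    using assms by auto
  also have "(\<lambda>k. (x k, x (Suc k mod (2 * n)))) ` \<dots> =
      (\<lambda>k. (x k, x (Suc k mod (2 * n)))) ` {0..<n - 1} \<union>
      (\<lambda>k. (x k, x (Suc k mod (2 * n)))) ` {n..<2 * n - 1} \<union>
      {(x (n - 1), x (Suc (n - 1) mod (2 * n))), (x (2 * n - 1), x (Suc (2 * n - 1) mod (2 * n)))}"
    by (simp add: image_Un)
  also have "(\<lambda>k. (x k, x (Suc k mod (2 * n)))) ` {0..<n - 1} = (\<lambda>i. (vv i, vv (i + 1))) ` {1..<n}"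
  proof -
    have "{1..<n} = Suc ` {0..<n - 1}" using assms by (simp add: image_Suc_atLeastLessThan)
    moreover have "(x k, x (Suc k mod (2 * n))) = (vv (Suc k), vv (Suc k + 1))"
      if "k \<in> {0..<n - 1}" for k
      using that by (simp add: x_def)
    ultimately show ?thesis by (simp only: image_image) (intro image_cong refl; simp)
  qed
  also have "(\<lambda>k. (x k, x (Suc k mod (2 * n)))) ` {n..<2 * n - 1} =
      (\<lambda>i. (uu (i + 1), uu i)) ` {1..<n}"
  proof -
    have "{n..<2 * n - 1} = (\<lambda>i. 2 * n - 1 - i) ` {1..<n}"
    proof
      show "{n..<2 * n - 1} \<subseteq> (\<lambda>i. 2 * n - 1 - i) ` {1..<n}"
        by (intro subsetI, rule_tac x = "2 * n - 1 - x" in image_eqI) auto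
    qed auto
    moreover have "(x (2 * n - 1 - i), x (Suc (2 * n - 1 - i) mod (2 * n))) = (uu (i + 1), uu i)"
      if "i \<in> {1..<n}" for i
    proof -
      have "Suc (2 * n - 1 - i) = 2 * n - i" using that by auto
      then have "Suc (2 * n - 1 - i) mod (2 * n) = 2 * n - i" using that by simp
      moreover have "\<not> 2 * n - 1 - i < n" "\<not> 2 * n - i < n" "2 * n - (2 * n - 1 - i) = i + 1"
        "2 * n - (2 * n - i) = i"
        using that by auto
      ultimately show ?thesis unfolding x_def by simp
    qed
    ultimately show ?thesis by (simp only: image_image) (intro image_cong refl; simp)
  qed
  also have "(x (n - 1), x (Suc (n - 1) mod (2 * n))) = (vv n, uu n)"
    using assms by (simp add: x_def)
  also have "(x (2 * n - 1), x (Suc (2 * n - 1) mod (2 * n))) = (uu 1, vv 1)"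
    using assms by (simp add: x_def)
  finally show ?thesis .
qed

lemma cycle_arcs_quadrangle:
  "cycle_arcs (quadrangle i) =
     {(vv i, uu i), (uu i, uu (i + 1)), (uu (i + 1), vv (i + 1)), (vv (i + 1), vv i)}"
  by (simp add: cycle_arcs_def quadrangle_def)

lemma ladder_parcs_faces:
  assumes "n \<ge> 1"
  shows "parcs (ladder n) =
     cycle_arcs (outer_cycle n) \<union> (\<Union>i \<in> {1..<n}. cycle_arcs (quadrangle i))"
proof -
  have 1: "{1..n} = insert n {1..<n}" using assms by auto
  have 2: "{1..n} = insert 1 ((\<lambda>i. i + 1) ` {1..<n})"
  proof -
    have "i \<in> (\<lambda>i. i + 1) ` {1..<n}" if "i \<in> {1..n}" "i \<noteq> 1" for i
      using that by (intro image_eqI[of _ _ "i - 1"]) auto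
    with assms show ?thesis by auto
  qed
  have "(\<lambda>i. (vv i, uu i)) ` {1..n} = insert (vv n, uu n) ((\<lambda>i. (vv i, uu i)) ` {1..<n})"
    by (subst 1) simp
  moreover have "(\<lambda>i. (uu i, vv i)) ` {1..n} =
      insert (uu 1, vv 1) ((\<lambda>i. (uu (i + 1), vv (i + 1))) ` {1..<n})"
    by (subst 2) (simp only: image_insert image_image)
  moreover have "(\<Union>i \<in> I. {a i, b i, c i, d i}) = a ` I \<union> b ` I \<union> c ` I \<union> d ` I"
    for I and a b c d :: "nat \<Rightarrow> (nat \<times> nat) \<times> (nat \<times> nat)"
    by auto
  moreover have "A \<union> B \<union> C \<union> D \<union> insert p E \<union> insert q F =
      A \<union> D \<union> {p, q} \<union> (E \<union> C \<union> F \<union> B)"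
    for A B C D E F and p q :: "(nat \<times> nat) \<times> (nat \<times> nat)"
    by auto
  ultimately show ?thesis
    unfolding ladder_parcs cycle_arcs_outer_cycle[OF assms] cycle_arcs_quadrangle
    by (simp only:)
qed

theorem ladder_facial_walks:
  assumes "n \<ge> 1"
  shows "facial_walks (ladder n) (ladder_rotation n) =
     insert (cycle_arcs (outer_cycle n)) ((\<lambda>i. cycle_arcs (quadrangle i)) ` {1..<n})"
proof -
  have "orbit (next_arc (ladder_rotation n)) ` cycle_arcs (outer_cycle n) =
      {cycle_arcs (outer_cycle n)}"
    using outer_cycle_orbit[OF assms] cycle_arcs_outer_cycle[OF assms] by auto
  moreover have quad: "orbit (next_arc (ladder_rotation n)) ` cycle_arcs (quadrangle i) =
      {cycle_arcs (quadrangle i)}" if "i \<in> {1..<n}" for i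
  proof -
    have "\<And>e. e \<in> cycle_arcs (quadrangle i) \<Longrightarrow>
        orbit (next_arc (ladder_rotation n)) e = cycle_arcs (quadrangle i)"
      using quadrangle_orbit that by auto
    moreover have "cycle_arcs (quadrangle i) \<noteq> {}" by (simp add: cycle_arcs_quadrangle)
    ultimately show ?thesis by auto
  qed
  moreover have "(\<Union>i \<in> {1..<n}. orbit (next_arc (ladder_rotation n)) ` cycle_arcs (quadrangle i)) =
      (\<lambda>i. cycle_arcs (quadrangle i)) ` {1..<n}"
  proof -
    have "(\<Union>i \<in> {1..<n}. orbit (next_arc (ladder_rotation n)) ` cycle_arcs (quadrangle i)) =
        (\<Union>i \<in> {1..<n}. {cycle_arcs (quadrangle i)})"
      by (intro SUP_cong refl quad)
    then show ?thesis by (simp only: UNION_singleton_eq_range)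
  qed
  ultimately show ?thesis
    unfolding facial_walks_def ladder_parcs_faces[OF assms] image_Un image_UN by (simp only: Un_insert_left Un_empty_left)
qed

theorem ladder_connected_plane_graph:
  assumes "n \<ge> 1"
  shows "connected_plane_graph (ladder n) (ladder_rotation n)"
proof -
  have outer: "(vv (i + 1), vv i) \<notin> cycle_arcs (outer_cycle n)" for i
    by (auto simp: cycle_arcs_outer_cycle[OF assms])
  have "inj_on (\<lambda>i. cycle_arcs (quadrangle i)) {1..<n}"
  proof (rule inj_onI)
    fix i j assume "cycle_arcs (quadrangle i) = cycle_arcs (quadrangle j)"
    then have "(vv i, uu i) \<in> cycle_arcs (quadrangle j)"
      using cycle_arcs_quadrangle[of i] by blast
    then show "i = j" by (simp add: cycle_arcs_quadrangle)
  qed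
  moreover have "cycle_arcs (outer_cycle n) \<notin> (\<lambda>i. cycle_arcs (quadrangle i)) ` {1..<n}"
    using outer by (auto simp: cycle_arcs_quadrangle)
  ultimately have "card (facial_walks (ladder n) (ladder_rotation n)) = n"
    using assms unfolding ladder_facial_walks[OF assms]
    by (subst card_insert_disjoint) (simp_all add: card_image)
  moreover have "card (pverts (ladder n)) = 2 * n"
    by (simp add: ladder_pverts card_cartesian_product)
  ultimately show ?thesis
    unfolding connected_plane_graph_def
    using assms card_ladder_parcs[OF assms] ladder_pair_graph ladder_connected[OF assms]
      ladder_rotation_system by simp
qed

end

theory Submission
  imports Defs "HOL-Number_Theory.Cong"
begin

text \<open>
  Number the vertices along the outer cycle by \<open>0, \<dots>, N - 1\<close> with \<open>N = 2n\<close>. Besides the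
  repetitions on arcs of the cycle it is enough to forbid equal colours on the rungs and on one
  diagonal of each quadrangle, so every vertex has at most two such extra conflicts.

  Colourings are counted in the manner of Rosenfeld. An extension of a valid colouring of S to
  x that produces a repetition is determined by its restriction to S without the half of the
  repetition that contains x. Hence, with 8 colours, the number of valid colourings of an
  interval avoiding \<open>N - 1\<close> grows at least by the factor 3 when the interval is extended at
  either end: at most \<open>2 + \<Sum> 3\<^sup>1\<^sup>-\<^sup>m = 7 / 2\<close> colours per colouring are lost. The last position
  \<open>N - 1\<close> closes the cycle and lies on \<open>2m\<close> arcs of length \<open>2m\<close>, where the loss is at most
  \<open>2 + \<Sum> 2m 3\<^sup>1\<^sup>-\<^sup>m = 13 / 2 < 8\<close>.
\<close>

section \<open>Counting colourings that avoid conflicts\<close>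

text \<open>With \<open>PiE\<close> the values outside \<open>S\<close> are fixed, so
  \<open>card\<close> counts each colouring of \<open>S\<close> once. A conflict binds only if it
  lies entirely inside \<open>S\<close>; hence restrictions of valid colourings stay valid.\<close>

definition avoiding :: "('v list \<times> 'v list) set \<Rightarrow> ('v \<Rightarrow> 'c set) \<Rightarrow> 'v set \<Rightarrow> ('v \<Rightarrow> 'c) set" where
  "avoiding C L S = {f \<in> PiE S L.
     \<forall>(xs, ys) \<in> C. set xs \<union> set ys \<subseteq> S \<longrightarrow> map f xs \<noteq> map f ys}"

lemma finite_avoiding:
  assumes "finite S" "\<And>v. v \<in> S \<Longrightarrow> finite (L v)"
  shows "finite (avoiding C L S)"
proof (rule finite_subset)
  show "avoiding C L S \<subseteq> PiE S L" by (auto simp: avoiding_def)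
  show "finite (PiE S L)" using assms by (intro finite_PiE) auto
qed

lemma restrict_avoiding:
  assumes "f \<in> avoiding C L S" "T \<subseteq> S"
  shows "restrict f T \<in> avoiding C L T"
proof -
  have restr: "map (restrict f T) xs = map f xs" if "set xs \<subseteq> T" for xs
    using that by (auto simp: restrict_def)
  have "f \<in> PiE S L"
    and avoid: "\<And>xs ys. (xs, ys) \<in> C \<Longrightarrow> set xs \<union> set ys \<subseteq> S \<Longrightarrow> map f xs \<noteq> map f ys"
    using assms(1) by (auto simp: avoiding_def)
  then have "restrict f T \<in> PiE T L" using assms(2) by (intro restrict_PiE_iff[THEN iffD2] ballI) auto
  moreover have "map (restrict f T) xs \<noteq> map (restrict f T) ys"
    if "(xs, ys) \<in> C" "set xs \<union> set ys \<subseteq> T" for xs ys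
    using avoid[OF that(1)] that(2) assms(2) restr[of xs] restr[of ys] by (metis Un_subset_iff order_trans)
  ultimately show ?thesis unfolding avoiding_def by blast
qed

text \<open>The union bound behind the counting method. \<open>I\<close> indexes the conflicts
  through \<open>x\<close>, oriented so that \<open>X t\<close> is the side containing
  \<open>x\<close>. An extension violating conflict \<open>t\<close> is charged to its restriction
  to \<open>S - set (X t)\<close>, which determines it.\<close>

lemma card_avoiding_insert:
  fixes X Y :: "'i \<Rightarrow> 'v list"
  assumes fin: "finite S" "\<And>v. v \<in> insert x S \<Longrightarrow> finite (L v)" "finite I"
    and x: "x \<notin> S"
    and I: "\<And>t. t \<in> I \<Longrightarrow> x \<in> set (X t) \<and> set (Y t) \<subseteq> S \<and> set (X t) \<inter> set (Y t) = {}"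
    and cover: "\<And>xs ys. (xs, ys) \<in> C \<Longrightarrow> set xs \<union> set ys \<subseteq> insert x S \<Longrightarrow> x \<in> set xs \<union> set ys \<Longrightarrow>
      \<exists>t \<in> I. (X t, Y t) = (xs, ys) \<or> (X t, Y t) = (ys, xs)"
  shows "card (L x) * card (avoiding C L S)
    \<le> card (avoiding C L (insert x S)) + (\<Sum>t \<in> I. card (avoiding C L (S - set (X t))))"
proof -
  \<comment> \<open>\<open>U\<close> consists of all one-point extensions, \<open>B t\<close> of
    those spoiled by conflict \<open>t\<close>.\<close>
  define U where "U = (\<lambda>(c, f). f(x := c)) ` (L x \<times> avoiding C L S)"
  define B where "B t = {g \<in> U. map g (X t) = map g (Y t)}" for t
  have ext: "f x = undefined" if "f \<in> avoiding C L S" for f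
    using that x by (auto simp: avoiding_def PiE_def extensional_def)
  have "inj_on (\<lambda>(c, f). f(x := c)) (L x \<times> avoiding C L S)"
  proof (intro inj_onI, clarify)
    fix c d f g
    assume fg: "f \<in> avoiding C L S" "g \<in> avoiding C L S" "f(x := c) = g(x := d)"
    then show "c = d \<and> f = g" by (metis ext fun_upd_idem_iff fun_upd_same fun_upd_upd)
  qed
  then have card_U: "card U = card (L x) * card (avoiding C L S)"
    unfolding U_def by (simp add: card_image card_cartesian_product)
  have U: "restrict g S \<in> avoiding C L S" "g \<in> PiE (insert x S) L" if g: "g \<in> U" for g
  proof -
    obtain c f where f: "c \<in> L x" "f \<in> avoiding C L S" "g = f(x := c)"
      using g by (auto simp: U_def)
    then have "f \<in> PiE S L" by (simp add: avoiding_def)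
    then have "restrict g S = f" using x f(3) by (auto simp: fun_eq_iff PiE_def extensional_def)
    with f show "restrict g S \<in> avoiding C L S" by simp
    show "g \<in> PiE (insert x S) L" using f \<open>f \<in> PiE S L\<close> by (auto simp: PiE_def extensional_def)
  qed
  have "finite U"
    unfolding U_def using fin by (intro finite_imageI finite_cartesian_product finite_avoiding) auto
  have sub: "U \<subseteq> avoiding C L (insert x S) \<union> (\<Union>t \<in> I. B t)"
  proof
    fix g assume g: "g \<in> U"
    show "g \<in> avoiding C L (insert x S) \<union> (\<Union>t \<in> I. B t)"
    proof (cases "g \<in> avoiding C L (insert x S)")
      case False
      then obtain xs ys where c: "(xs, ys) \<in> C" "set xs \<union> set ys \<subseteq> insert x S" "map g xs = map g ys"
        using U(2)[OF g] unfolding avoiding_def by blast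
      \<comment> \<open>A violated conflict that misses \<open>x\<close> would already be violated
        by the valid restriction to \<open>S\<close>.\<close>
      have "x \<in> set xs \<union> set ys"
      proof (rule ccontr)
        assume "x \<notin> set xs \<union> set ys"
        then have s: "set xs \<union> set ys \<subseteq> S" using c by blast
        then have "map (restrict g S) xs = map g xs" "map (restrict g S) ys = map g ys" by auto
        with U(1)[OF g] s c show False by (fastforce simp: avoiding_def)
      qed
      from cover[OF c(1,2) this] c(3) g show ?thesis unfolding B_def by force
    qed simp
  qed
  \<comment> \<open>Restriction is injective on \<open>B t\<close>: the colours on
    \<open>X t\<close> copy those on \<open>Y t\<close>, which lies in \<open>S\<close> and is
    disjoint from \<open>X t\<close>.\<close>
  have card_B: "card (B t) \<le> card (avoiding C L (S - set (X t)))" if t: "t \<in> I" for t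
  proof (rule card_inj_on_le[where f = "\<lambda>g. restrict g (S - set (X t))"])
    show "inj_on (\<lambda>g. restrict g (S - set (X t))) (B t)"
    proof (rule inj_onI)
      fix g h assume gh: "g \<in> B t" "h \<in> B t"
        and eq: "restrict g (S - set (X t)) = restrict h (S - set (X t))"
      have out: "g v = h v" if "v \<in> S - set (X t)" for v
        using eq that by (metis restrict_apply')
      have "map g (Y t) = map h (Y t)"
        using I[OF t] by (intro map_cong refl out) auto
      with gh have "map g (X t) = map h (X t)" by (simp add: B_def)
      then have "g v = h v" if "v \<in> set (X t)" for v using that by simp
      with out have "g v = h v" if "v \<in> insert x S" for v using that I[OF t] by blast
      moreover have "g \<in> PiE (insert x S) L" "h \<in> PiE (insert x S) L"
        using gh U(2) by (auto simp: B_def)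
      ultimately show "g = h" by (auto intro: PiE_ext)
    qed
    show "(\<lambda>g. restrict g (S - set (X t))) ` B t \<subseteq> avoiding C L (S - set (X t))"
    proof
      fix h assume "h \<in> (\<lambda>g. restrict g (S - set (X t))) ` B t"
      then obtain g where g: "g \<in> U" "h = restrict g (S - set (X t))" by (auto simp: B_def)
      then have "h = restrict (restrict g S) (S - set (X t))" by (auto simp: restrict_def)
      with restrict_avoiding[OF U(1)[OF g(1)]] show "h \<in> avoiding C L (S - set (X t))" by simp
    qed
    show "finite (avoiding C L (S - set (X t)))" using fin by (intro finite_avoiding) auto
  qed
  have "card U \<le> card (avoiding C L (insert x S) \<union> (\<Union>t \<in> I. B t))"
    using sub fin \<open>finite U\<close> by (intro card_mono) (auto intro!: finite_avoiding simp: B_def)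
  also have "\<dots> \<le> card (avoiding C L (insert x S)) + card (\<Union>t \<in> I. B t)" by (rule card_Un_le)
  also have "\<dots> \<le> card (avoiding C L (insert x S)) + (\<Sum>t \<in> I. card (B t))"
    using card_UN_le[OF fin(3)] by simp
  also have "\<dots> \<le> card (avoiding C L (insert x S)) + (\<Sum>t \<in> I. card (avoiding C L (S - set (X t))))"
    by (intro add_left_mono sum_mono card_B)
  finally show ?thesis by (simp add: card_U)
qed


section \<open>Non-repetitive colourings of a cycle with extra conflicts\<close>

text \<open>\<open>E\<close> is the graph of extra conflicts between positions of the cycle. Its
  degree bound makes them cost at most 2 of the 8 colours.\<close>

locale cyclic_colouring =
  fixes N :: nat and L :: "nat \<Rightarrow> 'c set" and E :: "nat \<Rightarrow> nat \<Rightarrow> bool"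
  assumes N: "N \<ge> 1"
    and finite_L: "p < N \<Longrightarrow> finite (L p)"
    and card_L: "p < N \<Longrightarrow> 8 \<le> card (L p)"
    and E_irrefl: "\<not> E p p"
    and E_sym: "E p q \<Longrightarrow> E q p"
    and E_degree: "p < N \<Longrightarrow> card {q. q < N \<and> E p q} \<le> 2"
begin

section \<open>Arcs of the cycle and their conflicts\<close>

definition arc :: "nat \<Rightarrow> nat \<Rightarrow> nat list" where
  "arc j m = map (\<lambda>i. i mod N) [j..<j + m]"

text \<open>The bound \<open>1 \<le> m\<close> excludes the pair of empty lists, which every
  colouring would violate; \<open>2 * m \<le> N\<close> keeps the two halves disjoint.\<close>

definition conflicts :: "(nat list \<times> nat list) set" where
  "conflicts = {(arc j m, arc (j + m) m) | j m. 1 \<le> m \<and> 2 * m \<le> N} \<union>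
     {([p], [q]) | p q. p < N \<and> q < N \<and> E p q}"

definition num :: "nat set \<Rightarrow> real" where
  "num S = real (card (avoiding conflicts L S))"

lemma arc_cong: "j mod N = k mod N \<Longrightarrow> arc j m = arc k m"
  unfolding arc_def by (rule nth_equalityI) (simp_all, metis mod_add_left_eq)

lemma set_arc: "set (arc j m) = {(j + i) mod N | i. i < m}"
proof -
  have "{j..<j + m} = (\<lambda>i. j + i) ` {..<m}"
    by (simp add: lessThan_atLeast0 add.commute)
  then show ?thesis unfolding arc_def by auto
qed

lemma arc_eq_upt: "j + m \<le> N \<Longrightarrow> arc j m = [j..<j + m]"
  unfolding arc_def by (rule map_idI) auto

text \<open>Offsets in the two halves differ by a number strictly between 0 and
  \<open>2 * m \<le> N\<close>, so they are not congruent modulo \<open>N\<close>.\<close>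

lemma arc_disjoint:
  assumes "2 * m \<le> N"
  shows "set (arc j m) \<inter> set (arc (j + m) m) = {}"
proof -
  have False if i: "i < m" "i' < m" "(j + i) mod N = (j + m + i') mod N" for i i'
  proof -
    have "N dvd (j + m + i') - (j + i)"
      using i by (subst mod_eq_dvd_iff_nat[symmetric]) auto
    moreover have "0 < (j + m + i') - (j + i)" "(j + m + i') - (j + i) < N"
      using i assms by auto
    ultimately show False by (meson nat_dvd_not_less)
  qed
  then show ?thesis unfolding set_arc by blast
qed

text \<open>The factor is 6 = 8 - 2, as the at most two \<open>E\<close>-conflicts of
  \<open>x\<close> are charged here. Only the arcs through \<open>x\<close> remain for
  \<open>I\<close>.\<close>

lemma num_insert:
  fixes X Y :: "'i \<Rightarrow> nat list"
  assumes S: "insert x S \<subseteq> {..<N}" "x \<notin> S" and I: "finite I"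
    and XY: "\<And>t. t \<in> I \<Longrightarrow> x \<in> set (X t) \<and> set (Y t) \<subseteq> S \<and> set (X t) \<inter> set (Y t) = {}"
    and cover: "\<And>j m. 1 \<le> m \<Longrightarrow> 2 * m \<le> N \<Longrightarrow>
      set (arc j m) \<union> set (arc (j + m) m) \<subseteq> insert x S \<Longrightarrow>
      x \<in> set (arc j m) \<union> set (arc (j + m) m) \<Longrightarrow>
      \<exists>t \<in> I. (X t, Y t) = (arc j m, arc (j + m) m) \<or> (X t, Y t) = (arc (j + m) m, arc j m)"
  shows "6 * num S \<le> num (insert x S) + (\<Sum>t \<in> I. num (S - set (X t)))"
proof -
  define D where "D = {q \<in> S. E x q}"
  let ?X = "case_sum X (\<lambda>q. [x])" and ?Y = "case_sum Y (\<lambda>q. [q])"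
  have finS: "finite S" using S finite_subset by auto
  have x: "x < N" using S by auto
  have D: "finite D" "card D \<le> 2"
  proof -
    show "finite D" using finS by (simp add: D_def)
    have "card D \<le> card {q. q < N \<and> E x q}"
      using S by (intro card_mono) (auto simp: D_def)
    with E_degree[OF x] show "card D \<le> 2" by simp
  qed
  have "card (L x) * card (avoiding conflicts L S) \<le> card (avoiding conflicts L (insert x S)) +
      (\<Sum>t \<in> I <+> D. card (avoiding conflicts L (S - set (?X t))))"
  proof (rule card_avoiding_insert[where Y = ?Y])
    show "finite (L v)" if "v \<in> insert x S" for v using finite_L S that by auto
    show "finite (I <+> D)" using I D by simp
    show "x \<in> set (?X t) \<and> set (?Y t) \<subseteq> S \<and> set (?X t) \<inter> set (?Y t) = {}" if "t \<in> I <+> D" for t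
      using that XY S by (force simp: D_def)
    fix xs ys assume c: "(xs, ys) \<in> conflicts" "set xs \<union> set ys \<subseteq> insert x S" "x \<in> set xs \<union> set ys"
    then consider j m where "1 \<le> m" "2 * m \<le> N" "xs = arc j m" "ys = arc (j + m) m"
      | p q where "E p q" "xs = [p]" "ys = [q]"
      by (auto simp: conflicts_def)
    then show "\<exists>t \<in> I <+> D. (?X t, ?Y t) = (xs, ys) \<or> (?X t, ?Y t) = (ys, xs)"
    proof cases
      case 1
      with cover[of m j] c obtain t where "t \<in> I" "(X t, Y t) = (xs, ys) \<or> (X t, Y t) = (ys, xs)"
        by blast
      then show ?thesis by (intro bexI[of _ "Inl t"]) auto
    next
      case 2
      then have "p \<noteq> q" using E_irrefl by blast
      with 2 c consider "p = x" "q \<in> D" | "q = x" "p \<in> D" using E_sym by (auto simp: D_def)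
      then show ?thesis
      proof cases
        case 1
        then show ?thesis using 2 by (intro bexI[of _ "Inr q"]) auto
      next
        case 2
        then show ?thesis using \<open>xs = [p]\<close> \<open>ys = [q]\<close> by (intro bexI[of _ "Inr p"]) auto
      qed
    qed
  qed (use S finS in auto)
  \<comment> \<open>For \<open>Inr q\<close> the removed side is \<open>[x]\<close> with
    \<open>x\<close> outside \<open>S\<close>, so every such term is the full count on
    \<open>S\<close>.\<close>
  also have "(\<Sum>t \<in> I <+> D. card (avoiding conflicts L (S - set (?X t)))) =
      (\<Sum>t \<in> I. card (avoiding conflicts L (S - set (X t)))) + card D * card (avoiding conflicts L S)"
    using I D S by (simp add: sum.Plus)
  finally have "real (card (L x)) * num S \<le> num (insert x S) +
      ((\<Sum>t \<in> I. num (S - set (X t))) + real (card D) * num S)"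
    unfolding num_def of_nat_sum[symmetric] of_nat_mult[symmetric] of_nat_add[symmetric] of_nat_le_iff .
  moreover have "8 * num S \<le> real (card (L x)) * num S"
    using card_L[OF x] by (intro mult_right_mono) (auto simp: num_def)
  moreover have "real (card D) * num S \<le> 2 * num S"
    using D by (intro mult_right_mono) (auto simp: num_def)
  ultimately show ?thesis by linarith
qed

section \<open>Growth of the count on intervals\<close>

lemma sum_geometric_le: "(\<Sum>m = 1..M. (1 / 3 :: real) ^ (m - 1)) \<le> 3 / 2"
proof -
  have "(\<Sum>m = 1..M. (1 / 3 :: real) ^ (m - 1)) = 3 / 2 - 3 / 2 * (1 / 3) ^ M"
    by (induction M) (simp_all add: algebra_simps del: power_one_over)
  then show ?thesis by simp
qed

lemma sum_arithmetic_geometric_le: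
  "(\<Sum>m = 1..M. 2 * real m * (1 / 3 :: real) ^ (m - 1)) \<le> 9 / 2"
proof -
  have "(\<Sum>m = 1..M. 2 * real m * (1 / 3 :: real) ^ (m - 1)) = 9 / 2 - (9 / 2 + 3 * real M) * (1 / 3) ^ M"
    by (induction M) (simp_all add: algebra_simps del: power_one_over)
  moreover have "0 \<le> (9 / 2 + 3 * real M) * (1 / 3 :: real) ^ M" by simp
  ultimately show ?thesis by linarith
qed

text \<open>At an endpoint each length \<open>m\<close> contributes only one conflict, so the loss
  is a plain geometric sum and 6 - 3/2 = 9/2 remains, more than the required 3.\<close>

lemma num_insert_endpoint:
  fixes X Y :: "nat \<Rightarrow> nat list"
  assumes "insert x S \<subseteq> {..<N}" "x \<notin> S"
    and "\<And>m. m \<in> {1..M} \<Longrightarrow> x \<in> set (X m) \<and> set (Y m) \<subseteq> S \<and> set (X m) \<inter> set (Y m) = {}"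
    and "\<And>j m. 1 \<le> m \<Longrightarrow> 2 * m \<le> N \<Longrightarrow>
      set (arc j m) \<union> set (arc (j + m) m) \<subseteq> insert x S \<Longrightarrow>
      x \<in> set (arc j m) \<union> set (arc (j + m) m) \<Longrightarrow>
      \<exists>t \<in> {1..M}. (X t, Y t) = (arc j m, arc (j + m) m) \<or> (X t, Y t) = (arc (j + m) m, arc j m)"
    and decay: "\<And>m. m \<in> {1..M} \<Longrightarrow> num (S - set (X m)) \<le> (1 / 3) ^ (m - 1) * num S"
  shows "3 * num S \<le> num (insert x S)"
proof -
  have "6 * num S \<le> num (insert x S) + (\<Sum>m = 1..M. num (S - set (X m)))"
    using assms(3) by (intro num_insert[where Y = Y] assms(1,2,4) finite_atLeastAtMost) auto
  also have "(\<Sum>m = 1..M. num (S - set (X m))) \<le> (\<Sum>m = 1..M. (1 / 3) ^ (m - 1) * num S)"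
    by (intro sum_mono decay)
  also have "\<dots> = (\<Sum>m = 1..M. (1 / 3) ^ (m - 1)) * num S" by (simp add: sum_distrib_right)
  also have "\<dots> \<le> 3 / 2 * num S"
    by (intro mult_right_mono sum_geometric_le) (simp add: num_def)
  finally show ?thesis by (simp add: num_def)
qed

text \<open>Two consecutive arcs that wrap around the end of the numbering, or just reach it, pass
  through \<open>N - 1\<close>. Without that position they are ordinary intervals.\<close>

lemma arc_avoiding_last:
  assumes "1 \<le> m" "2 * m \<le> N" "set (arc j m) \<union> set (arc (j + m) m) \<subseteq> {..<N - 1}"
  obtains k where "k + 2 * m \<le> N - 1" "arc j m = [k..<k + m]" "arc (j + m) m = [k + m..<k + 2 * m]"
proof -
  define k where "k = j mod N"
  have k: "k < N" using N by (simp add: k_def)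
  have eq: "arc j m = arc k m" "arc (j + m) m = arc (k + m) m"
    by (auto intro!: arc_cong simp: k_def mod_simps)
  have "k + 2 * m \<le> N - 1"
  proof (rule ccontr)
    assume "\<not> k + 2 * m \<le> N - 1"
    then obtain i where i: "i < 2 * m" "k + i = N - 1"
      using k by (intro that[of "N - 1 - k"]) auto
    then have "(k + i) mod N = N - 1" using N by simp
    moreover have "(k + i) mod N \<in> set (arc k m) \<union> set (arc (k + m) m)"
    proof (cases "i < m")
      case False
      then have "(k + i) mod N = (k + m + (i - m)) mod N" "i - m < m" using i by auto
      then show ?thesis unfolding set_arc by blast
    qed (auto simp: set_arc)
    ultimately show False using assms(3) eq by auto
  qed
  then show thesis
    using assms(1) by (intro that[of k]) (auto simp: eq arc_eq_upt mult_2 add.assoc)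
qed

text \<open>Strong induction on the length: the growth factor 3 on shorter intervals, iterated, is
  exactly the decay that \<open>num_insert_endpoint\<close> asks for.\<close>

lemma num_interval:
  assumes "a < b" "b \<le> N - 1"
  shows "3 * num {a..<b - 1} \<le> num {a..<b} \<and> 3 * num {Suc a..<b} \<le> num {a..<b}"
  using assms
proof (induction "b - a" arbitrary: a b rule: less_induct)
  case less
  \<comment> \<open>The induction hypothesis, applied once for each of the \<open>i\<close> points
    cut off; \<open>left\<close> is its mirror image.\<close>
  have right: "num {a'..<b' - i} \<le> (1 / 3) ^ i * num {a'..<b'}"
    if "a' + i \<le> b'" "b' \<le> N - 1" "b' - a' < b - a" for a' b' i
    using that
  proof (induction i)
    case (Suc i)
    have "num {a'..<b' - Suc i} \<le> 1 / 3 * num {a'..<b' - i}"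
      using less.hyps[of "b' - i" a'] Suc.prems by force
    with Suc show ?case by simp
  qed simp
  have left: "num {a' + i..<b'} \<le> (1 / 3) ^ i * num {a'..<b'}"
    if "a' + i \<le> b'" "b' \<le> N - 1" "b' - a' < b - a" for a' b' i
    using that
  proof (induction i)
    case (Suc i)
    have "num {a' + Suc i..<b'} \<le> 1 / 3 * num {a' + i..<b'}"
      using less.hyps[of b' "a' + i"] Suc.prems by force
    with Suc show ?case by simp
  qed simp
  have ins: "insert (b - 1) {a..<b - 1} = {a..<b}" "insert a {Suc a..<b} = {a..<b}"
    using less.prems by auto
  \<comment> \<open>Halves of a repetition inside \<open>{a..<b}\<close> have length at most
    \<open>M\<close>.\<close>
  define M where "M = (b - a) div 2"
  have M: "2 * m \<le> b - a" if "m \<le> M" for m using that by (auto simp: M_def)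
  have "3 * num {a..<b - 1} \<le> num (insert (b - 1) {a..<b - 1})"
  proof (rule num_insert_endpoint[where X = "\<lambda>m. [b - m..<b]" and Y = "\<lambda>m. [b - 2 * m..<b - m]" and M = M])
    fix m assume m: "m \<in> {1..M}"
    note M[of m]
    with m show "b - 1 \<in> set [b - m..<b] \<and> set [b - 2 * m..<b - m] \<subseteq> {a..<b - 1} \<and>
        set [b - m..<b] \<inter> set [b - 2 * m..<b - m] = {}"
      by auto
    \<comment> \<open>The point \<open>b - 1\<close> is already missing, so removing a half of
      length \<open>m\<close> cuts off only \<open>m - 1\<close> points.\<close>
    have "{a..<b - 1} - set [b - m..<b] = {a..<b - 1 - (m - 1)}" using m by auto
    with right[of a "m - 1" "b - 1"] m M[of m] less.prems
    show "num ({a..<b - 1} - set [b - m..<b]) \<le> (1 / 3) ^ (m - 1) * num {a..<b - 1}"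
      by auto
  next
    fix j m assume h: "1 \<le> m" "2 * m \<le> N"
      "set (arc j m) \<union> set (arc (j + m) m) \<subseteq> insert (b - 1) {a..<b - 1}"
      "b - 1 \<in> set (arc j m) \<union> set (arc (j + m) m)"
    have "set (arc j m) \<union> set (arc (j + m) m) \<subseteq> {..<N - 1}"
      using h(3) less.prems unfolding ins by fastforce
    from arc_avoiding_last[OF h(1,2) this] obtain k where k: "k + 2 * m \<le> N - 1"
      "arc j m = [k..<k + m]" "arc (j + m) m = [k + m..<k + 2 * m]" .
    \<comment> \<open>Since \<open>b - 1\<close> is the largest point available, a repetition
      through it must end there, and its second half is the one to recolour.\<close>
    have "{k..<k + 2 * m} \<subseteq> {a..<b}" "b - 1 \<in> {k..<k + 2 * m}"
      using h k ins by auto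
    then have "k \<ge> a" "k + 2 * m = b" using h(1) less.prems by auto
    then have m: "m \<in> {1..M}" "b - m = k + m" "b - 2 * m = k"
      using h(1) by (auto simp: M_def)
    have "[b - m..<b] = arc (j + m) m" "[b - 2 * m..<b - m] = arc j m"
      unfolding k m(2,3) using \<open>k + 2 * m = b\<close> by simp_all
    with m(1) show "\<exists>t \<in> {1..M}. ([b - t..<b], [b - 2 * t..<b - t]) = (arc j m, arc (j + m) m) \<or>
        ([b - t..<b], [b - 2 * t..<b - t]) = (arc (j + m) m, arc j m)"
      by (intro bexI[of _ m]) auto
  qed (use less.prems in auto)
  moreover have "3 * num {Suc a..<b} \<le> num (insert a {Suc a..<b})"
  proof (rule num_insert_endpoint[where X = "\<lambda>m. [a..<a + m]" and Y = "\<lambda>m. [a + m..<a + 2 * m]" and M = M])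
    fix m assume m: "m \<in> {1..M}"
    note M[of m]
    with m show "a \<in> set [a..<a + m] \<and> set [a + m..<a + 2 * m] \<subseteq> {Suc a..<b} \<and>
        set [a..<a + m] \<inter> set [a + m..<a + 2 * m] = {}"
      by auto
    have "{Suc a..<b} - set [a..<a + m] = {Suc a + (m - 1)..<b}" using m by auto
    with left[of "Suc a" "m - 1" b] m M[of m] less.prems
    show "num ({Suc a..<b} - set [a..<a + m]) \<le> (1 / 3) ^ (m - 1) * num {Suc a..<b}"
      by auto
  next
    fix j m assume h: "1 \<le> m" "2 * m \<le> N"
      "set (arc j m) \<union> set (arc (j + m) m) \<subseteq> insert a {Suc a..<b}"
      "a \<in> set (arc j m) \<union> set (arc (j + m) m)"
    have "set (arc j m) \<union> set (arc (j + m) m) \<subseteq> {..<N - 1}"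
      using h(3) less.prems unfolding ins by fastforce
    from arc_avoiding_last[OF h(1,2) this] obtain k where k: "k + 2 * m \<le> N - 1"
      "arc j m = [k..<k + m]" "arc (j + m) m = [k + m..<k + 2 * m]" .
    have "{k..<k + 2 * m} \<subseteq> {a..<b}" "a \<in> {k..<k + 2 * m}"
      using h k ins by auto
    then have "k = a" "k + 2 * m \<le> b" using h(1) less.prems by auto
    then have "m \<in> {1..M}" using h(1) by (auto simp: M_def)
    then show "\<exists>t \<in> {1..M}. ([a..<a + t], [a + t..<a + 2 * t]) = (arc j m, arc (j + m) m) \<or>
        ([a..<a + t], [a + t..<a + 2 * t]) = (arc (j + m) m, arc j m)"
      using k \<open>k = a\<close> by (intro bexI[of _ m]) auto
  qed (use less.prems in auto)
  ultimately show ?case unfolding ins by blast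
qed

lemma num_shrink_right: "a + i \<le> b \<Longrightarrow> b \<le> N - 1 \<Longrightarrow> num {a..<b - i} \<le> (1 / 3) ^ i * num {a..<b}"
proof (induction i)
  case (Suc i)
  then have "a < b - i" "b - i \<le> N - 1" by auto
  from num_interval[OF this] Suc show ?case by simp
qed simp

lemma num_shrink_left: "a + i \<le> b \<Longrightarrow> b \<le> N - 1 \<Longrightarrow> num {a + i..<b} \<le> (1 / 3) ^ i * num {a..<b}"
proof (induction i)
  case (Suc i)
  then have "a + i < b" by simp
  from num_interval[OF this] Suc show ?case by simp
qed simp

lemma num_pos_interval: "b \<le> N - 1 \<Longrightarrow> num {0..<b} > 0"
proof (induction b)
  case 0
  \<comment> \<open>Conflict lists are nonempty, so none lies inside the empty set and the empty
    colouring is valid.\<close>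
  have "(\<lambda>_. undefined) \<in> avoiding conflicts L {}"
    by (auto simp: avoiding_def conflicts_def arc_def)
  moreover have "finite (avoiding conflicts L {})" by (rule finite_avoiding) auto
  ultimately show ?case by (auto simp: num_def card_gt_0_iff)
next
  case (Suc b)
  then show ?case using num_interval[of 0 "Suc b"] by simp
qed

section \<open>Closing the cycle at the last position\<close>

lemma set_arc_last:
  assumes "a < m" "2 * m \<le> N"
  shows "set (arc (N - m + a) m) = {N - m + a..<N} \<union> {..<a}"
proof -
  have "(N - m + a + i) mod N = (if i < m - a then N - m + a + i else i - (m - a))" if "i < m" for i
    using that assms by (auto simp: mod_if)
  then have "set (arc (N - m + a) m) =
      (\<lambda>i. if i < m - a then N - m + a + i else i - (m - a)) ` {..<m}"
    unfolding set_arc by force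
  also have "\<dots> = {N - m + a..<N} \<union> {..<a}" (is "?l = ?r")
  proof
    show "?l \<subseteq> ?r" using assms by auto
    show "?r \<subseteq> ?l"
    proof
      fix y assume "y \<in> ?r"
      then consider "N - m + a \<le> y" "y < N" | "y < a" by auto
      then show "y \<in> ?l"
      proof cases
        case 1
        then show ?thesis using assms by (intro image_eqI[of _ _ "y - (N - m + a)"]) auto
      next
        case 2
        then show ?thesis using assms by (intro image_eqI[of _ _ "y + (m - a)"]) auto
      qed
    qed
  qed
  finally show ?thesis .
qed

text \<open>A half through \<open>N - 1\<close> may wrap around, but removing it from
  \<open>{0..<N - 1}\<close> only trims the two ends, by \<open>m - 1\<close> points in total. So
  the interval bounds still apply, now with \<open>2 * m\<close> conflicts for each length
  \<open>m\<close>.\<close>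

lemma num_full_pos: "num {..<N} > 0"
proof -
  define S where "S = {0..<N - 1}"
  define M where "M = N div 2"
  have M: "2 * m \<le> N" if "m \<le> M" for m using that by (auto simp: M_def)
  \<comment> \<open>\<open>(m, a, r)\<close>: the half of length \<open>m\<close> containing \<open>N - 1\<close> has \<open>a\<close> further positions after it,
    and \<open>r\<close> tells whether the other half follows or precedes\<close>
  define I where "I = Sigma {1..M} (\<lambda>m. {..<m} \<times> (UNIV :: bool set))"
  define X where "X = (\<lambda>(m, a, r :: bool). arc (N - m + a) m)"
  \<comment> \<open>The other half starts \<open>m\<close> places after or before
    \<open>N - m + a\<close>. Writing \<open>N + a\<close> and \<open>N - 2 * m + a\<close> keeps
    the subtraction from truncating when \<open>2 * m \<le> N\<close>.\<close>
  define Y where "Y = (\<lambda>(m, a, r). if r then arc (N + a) m else arc (N - 2 * m + a) m)"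
  have ins: "insert (N - 1) S = {..<N}" using N by (auto simp: S_def)
  have X: "set (X (m, a, r)) = {N - m + a..<N} \<union> {..<a}" if "(m, a, r) \<in> I" for m a r
    using that M[of m] set_arc_last[of a m] by (simp add: X_def I_def)
  have "6 * num S \<le> num (insert (N - 1) S) + (\<Sum>t \<in> I. num (S - set (X t)))"
  proof (rule num_insert[where Y = Y])
    fix t assume t: "t \<in> I"
    obtain m a r where mar: "t = (m, a, r)" by (cases t)
    have m: "1 \<le> m" "a < m" "2 * m \<le> N" using t M[of m] by (auto simp: I_def mar)
    have last: "N - 1 \<in> set (X t)" using X[of m a r] t m by (auto simp: mar)
    have dis: "set (X t) \<inter> set (Y t) = {}"
    proof (cases r)
      case True
      have "N - m + a + m = N + a" using m by simp
      with arc_disjoint[OF m(3), of "N - m + a"] True show ?thesis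
        by (simp add: X_def Y_def mar)
    next
      case False
      have "N - 2 * m + a + m = N - m + a" using m by simp
      with arc_disjoint[OF m(3), of "N - 2 * m + a"] False show ?thesis
        by (auto simp add: X_def Y_def mar)
    qed
    have "set (Y t) \<subseteq> {..<N}" using N by (auto simp: Y_def mar set_arc)
    with last dis have "set (Y t) \<subseteq> S" unfolding ins[symmetric] by blast
    with last dis show "N - 1 \<in> set (X t) \<and> set (Y t) \<subseteq> S \<and> set (X t) \<inter> set (Y t) = {}" by blast
  next
    fix j m assume m: "1 \<le> m" "2 * m \<le> N" and "N - 1 \<in> set (arc j m) \<union> set (arc (j + m) m)"
    \<comment> \<open>If \<open>N - 1\<close> has index \<open>i\<close> in the arc, then
      \<open>a = m - 1 - i\<close> positions of the arc come after it.\<close>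
    have offset: "\<exists>a < m. k mod N = (N - m + a) mod N" if "N - 1 \<in> set (arc k m)" for k
    proof -
      obtain i where i: "i < m" "(k + i) mod N = N - 1" using \<open>N - 1 \<in> set (arc k m)\<close> by (auto simp: set_arc)
      have "(k + i) mod N = (N - m + (m - 1 - i) + i) mod N" using i m by simp
      then have "k mod N = (N - m + (m - 1 - i)) mod N"
        unfolding cong_def[symmetric] cong_add_rcancel_nat .
      then show ?thesis using i by (intro exI[of _ "m - 1 - i"]) auto
    qed
    have mM: "m \<in> {1..M}" using m by (auto simp: M_def)
    from \<open>N - 1 \<in> set (arc j m) \<union> set (arc (j + m) m)\<close>
    show "\<exists>t \<in> I. (X t, Y t) = (arc j m, arc (j + m) m) \<or> (X t, Y t) = (arc (j + m) m, arc j m)"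
    proof
      assume "N - 1 \<in> set (arc j m)"
      from offset[OF this] obtain a where a: "a < m" "j mod N = (N - m + a) mod N" by blast
      then have "(j + m) mod N = (N - m + a + m) mod N" by (metis mod_add_left_eq)
      also have "N - m + a + m = N + a" using m by simp
      finally have "arc (j + m) m = arc (N + a) m" by (rule arc_cong)
      moreover have "arc j m = arc (N - m + a) m" using a by (intro arc_cong)
      ultimately show ?thesis using a mM
        by (intro bexI[of _ "(m, a, True)"]) (auto simp: X_def Y_def I_def)
    next
      assume "N - 1 \<in> set (arc (j + m) m)"
      from offset[OF this] obtain a where a: "a < m" "(j + m) mod N = (N - m + a) mod N" by blast
      have "N - m + a = N - 2 * m + a + m" using m by simp
      with a have "(j + m) mod N = (N - 2 * m + a + m) mod N" by simp
      then have "j mod N = (N - 2 * m + a) mod N"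
        unfolding cong_def[symmetric] cong_add_rcancel_nat .
      then have "arc j m = arc (N - 2 * m + a) m" by (rule arc_cong)
      moreover have "arc (j + m) m = arc (N - m + a) m" using a by (intro arc_cong)
      ultimately show ?thesis using a mM
        by (intro bexI[of _ "(m, a, False)"]) (auto simp: X_def Y_def I_def)
    qed
  next
    show "insert (N - 1) S \<subseteq> {..<N}" by (simp only: ins)
    show "N - 1 \<notin> S" by (simp add: S_def)
    show "finite I" by (auto simp: I_def)
  qed
  also have "(\<Sum>t \<in> I. num (S - set (X t))) \<le> (\<Sum>t \<in> I. (1 / 3) ^ (fst t - 1) * num S)"
  proof (rule sum_mono)
    fix t assume t: "t \<in> I"
    obtain m a r where mar: "t = (m, a, r)" by (cases t)
    have m: "1 \<le> m" "a < m" "2 * m \<le> N" using t M[of m] by (auto simp: I_def mar)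
    \<comment> \<open>The wrapped part cuts \<open>a\<close> points off the left end, the rest of
      the half cuts \<open>m - 1 - a\<close> off the right end.\<close>
    have "S - set (X t) = {0 + a..<N - 1 - (m - 1 - a)}"
      unfolding mar S_def X[OF t[unfolded mar]] using m by auto
    then have "num (S - set (X t)) = num {0 + a..<N - 1 - (m - 1 - a)}" by simp
    also have "\<dots> \<le> (1 / 3) ^ a * num {0..<N - 1 - (m - 1 - a)}"
      using m by (intro num_shrink_left) auto
    also have "\<dots> \<le> (1 / 3) ^ a * ((1 / 3) ^ (m - 1 - a) * num S)"
      unfolding S_def using m by (intro mult_left_mono num_shrink_right) auto
    also have "\<dots> = (1 / 3) ^ (m - 1) * num S"
      using m by (simp add: mult.assoc[symmetric] power_add[symmetric] del: power_one_over)
    finally show "num (S - set (X t)) \<le> (1 / 3) ^ (fst t - 1) * num S" by (simp add: mar)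
  qed
  also have "\<dots> = (\<Sum>m = 1..M. \<Sum>ar \<in> {..<m} \<times> (UNIV :: bool set). (1 / 3) ^ (m - 1) * num S)"
    unfolding I_def by (subst sum.Sigma) (auto intro: sum.cong)
  also have "\<dots> = (\<Sum>m = 1..M. 2 * real m * (1 / 3) ^ (m - 1)) * num S"
    by (simp add: card_cartesian_product sum_distrib_left mult_ac)
  also have "\<dots> \<le> 9 / 2 * num S"
    by (intro mult_right_mono sum_arithmetic_geometric_le) (simp add: num_def)
  \<comment> \<open>Here 3/2 = 6 - 9/2, which is positive.\<close>
  finally have "3 / 2 * num S \<le> num {..<N}" unfolding ins by simp
  moreover have "num S > 0" unfolding S_def by (rule num_pos_interval) simp
  ultimately show ?thesis by linarith
qed

lemma ex_colouring:
  obtains f where "\<And>p. p < N \<Longrightarrow> f p \<in> L p"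
    "\<And>p q. p < N \<Longrightarrow> q < N \<Longrightarrow> E p q \<Longrightarrow> f p \<noteq> f q"
    "\<And>j m. 1 \<le> m \<Longrightarrow> 2 * m \<le> N \<Longrightarrow> \<exists>i < m. f ((j + i) mod N) \<noteq> f ((j + m + i) mod N)"
proof -
  obtain f where f: "f \<in> avoiding conflicts L {..<N}"
    using num_full_pos by (force simp: num_def card_gt_0_iff)
  then have avoid: "map f xs \<noteq> map f ys" if "(xs, ys) \<in> conflicts" "set xs \<union> set ys \<subseteq> {..<N}" for xs ys
    using that by (auto simp: avoiding_def)
  show thesis
  proof
    show "f p \<in> L p" if "p < N" for p using f that by (auto simp: avoiding_def)
    show "f p \<noteq> f q" if "p < N" "q < N" "E p q" for p q
      using avoid[of "[p]" "[q]"] that by (auto simp: conflicts_def)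
    fix j m :: nat assume m: "1 \<le> m" "2 * m \<le> N"
    have "map f (arc j m) \<noteq> map f (arc (j + m) m)"
      using m N by (intro avoid) (auto simp: conflicts_def set_arc)
    then show "\<exists>i < m. f ((j + i) mod N) \<noteq> f ((j + m + i) mod N)"
      by (auto simp: arc_def list_eq_iff_nth_eq)
  qed
qed

end


section \<open>Facial paths of the ladder\<close>

text \<open>The form \<open>s @ s\<close> is visibly preserved by reversal, so facial paths need to
  be treated in one direction only.\<close>

lemma repetition_iff_append: "repetition r \<longleftrightarrow> (\<exists>s. s \<noteq> [] \<and> r = s @ s)"
proof
  assume "repetition r"
  then obtain m where m: "m \<ge> 1" "length r = 2 * m" "\<forall>i < m. r ! i = r ! (m + i)"
    by (auto simp: repetition_def)
  then have "take m r = drop m r" by (intro nth_equalityI) auto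
  then have "r = take m r @ take m r" by (metis append_take_drop_id)
  moreover have "take m r \<noteq> []" using m by auto
  ultimately show "\<exists>s. s \<noteq> [] \<and> r = s @ s" by blast
next
  assume "\<exists>s. s \<noteq> [] \<and> r = s @ s"
  then show "repetition r"
    unfolding repetition_def by (elim exE conjE, intro exI[of _ "length s" for s])
      (auto simp: nth_append Suc_le_eq)
qed

lemma repetition_rev [simp]: "repetition (rev r) \<longleftrightarrow> repetition r"
proof -
  have "repetition (rev r)" if "repetition r" for r :: "'a list"
    using that unfolding repetition_iff_append by (metis rev_append rev_is_Nil_conv)
  from this[of r] this[of "rev r"] show ?thesis by auto
qed

text \<open>As \<open>xs\<close> is distinct, an arc of the cycle is determined by its tail. A walk
  that never leaves \<open>cycle_arcs xs\<close> therefore has to run along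
  \<open>xs\<close>.\<close>

lemma fst_next_arc_cycle:
  assumes "distinct xs"
    and closed: "\<And>e. e \<in> cycle_arcs xs \<Longrightarrow> next_arc R e \<in> cycle_arcs xs"
    and "e \<in> cycle_arcs xs"
  obtains j where "j < length xs"
    "\<And>k. fst ((next_arc R ^^ k) e) = xs ! ((j + k) mod length xs)"
proof -
  let ?l = "length xs"
  have arcs: "cycle_arcs xs = {(xs ! i, xs ! (Suc i mod ?l)) | i. i < ?l}"
    unfolding cycle_arcs_def set_zip by (auto simp: nth_rotate1)
  then obtain j where j: "j < ?l" "e = (xs ! j, xs ! (Suc j mod ?l))" using assms(3) by auto
  have l: "i mod ?l < ?l" for i using j by (intro mod_less_divisor) auto
  have "(next_arc R ^^ k) e = (xs ! ((j + k) mod ?l), xs ! (Suc (j + k) mod ?l))" for k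
  proof (induction k)
    case (Suc k)
    let ?b = "xs ! (Suc (j + k) mod ?l)"
    obtain c where c: "next_arc R (xs ! ((j + k) mod ?l), ?b) = (?b, c)" by simp
    have "(xs ! ((j + k) mod ?l), ?b) \<in> cycle_arcs xs"
      unfolding arcs using l by (auto intro!: exI[of _ "(j + k) mod ?l"] simp: mod_Suc_eq)
    from closed[OF this] obtain i where i: "i < ?l" "?b = xs ! i" "c = xs ! (Suc i mod ?l)"
      unfolding c arcs by auto
    then have "i = Suc (j + k) mod ?l" using nth_eq_iff_index_eq[OF assms(1) l] by metis
    with i(3) have "c = xs ! (Suc (Suc (j + k)) mod ?l)" by (simp only: mod_Suc_eq)
    then show ?case by (simp add: Suc.IH c del: next_arc.simps)
  qed (use j in simp)
  with j that show thesis by auto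
qed

text \<open>Every arc lies on the outer cycle or on a quadrangle, and the orbit lemmas show that
  \<open>next_arc\<close> does not leave that face.\<close>

lemma ladder_boundary_segment:
  assumes "n \<ge> 1" "boundary_segment (ladder n) (ladder_rotation n) p"
  obtains c j where "c = outer_cycle n \<or> (\<exists>i \<in> {1..<n}. c = quadrangle i)" "j < length c"
    "p = map (\<lambda>k. c ! ((j + k) mod length c)) [0..<length p]"
proof -
  let ?R = "ladder_rotation n"
  obtain e where e: "e \<in> parcs (ladder n)"
    "p = map (\<lambda>k. fst ((next_arc ?R ^^ k) e)) [0..<length p]"
    using assms(2) unfolding boundary_segment_def by blast
  from e(1) obtain c where c: "c = outer_cycle n \<or> (\<exists>i \<in> {1..<n}. c = quadrangle i)" "e \<in> cycle_arcs c"
    unfolding ladder_parcs_faces[OF assms(1)] by blast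
  have "distinct c"
    using c(1) by (auto simp: outer_cycle_def quadrangle_def distinct_map inj_on_def)
  moreover have "next_arc ?R a \<in> cycle_arcs c" if "a \<in> cycle_arcs c" for a
    using c(1) that outer_cycle_orbit[OF assms(1), of a] quadrangle_orbit[of _ n a]
      orbit.base[of "next_arc ?R" a]
    by (auto simp del: next_arc.simps ladder_rotation.simps)
  ultimately obtain j where j: "j < length c"
    "\<And>k. fst ((next_arc ?R ^^ k) e) = c ! ((j + k) mod length c)"
    using fst_next_arc_cycle c(2) by metis
  show thesis using that[OF c(1) j(1)] e(2) unfolding j(2) .
qed

section \<open>Colouring the ladder along its outer cycle\<close>

definition position :: "nat \<Rightarrow> nat \<times> nat \<Rightarrow> nat" where
  "position n = (\<lambda>(i, j). if j = 1 then i - 1 else 2 * n - i)"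

lemma position_outer_cycle: "k < 2 * n \<Longrightarrow> position n (outer_cycle n ! k) = k"
  by (simp add: nth_outer_cycle position_def)

text \<open>The outer face is covered by \<open>cyc\<close>. On a quadrangle a repetition of length
  2 is an edge with equal colours, and one of length 4 makes both diagonals monochromatic, so one
  properly coloured diagonal suffices.\<close>

lemma facial_nonrepetitive_ladder:
  fixes f :: "nat \<Rightarrow> 'c"
  assumes n: "n \<ge> 1"
    and E: "\<And>p q. p < 2 * n \<Longrightarrow> q < 2 * n \<Longrightarrow> p \<noteq> q \<Longrightarrow> p + q \<in> {2 * n - 1, 2 * n} \<Longrightarrow> f p \<noteq> f q"
    and cyc: "\<And>j m. 1 \<le> m \<Longrightarrow> 2 * m \<le> 2 * n \<Longrightarrow>
      \<exists>i < m. f ((j + i) mod (2 * n)) \<noteq> f ((j + m + i) mod (2 * n))"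
  shows "facial_nonrepetitive (ladder n) (ladder_rotation n) (f \<circ> position n)"
proof -
  let ?\<phi> = "f \<circ> position n"
  have segment: "\<not> repetition (map ?\<phi> p)"
    if p: "boundary_segment (ladder n) (ladder_rotation n) p" "distinct p" for p
  proof
    assume "repetition (map ?\<phi> p)"
    then obtain m where m: "m \<ge> 1" "length p = 2 * m" "\<And>i. i < m \<Longrightarrow> ?\<phi> (p ! i) = ?\<phi> (p ! (m + i))"
      by (auto simp: repetition_def)
    obtain c j where c: "c = outer_cycle n \<or> (\<exists>i \<in> {1..<n}. c = quadrangle i)" and j: "j < length c"
      and pc: "p = map (\<lambda>k. c ! ((j + k) mod length c)) [0..<length p]"
      using ladder_boundary_segment[OF n p(1)] .
    have nth: "p ! k = c ! ((j + k) mod length c)" if "k < 2 * m" for k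
      by (subst pc) (simp add: m(2) that)
    \<comment> \<open>A path repeats no vertex, so \<open>2 * m\<close> is at most the length of the
      face; this is what \<open>cyc\<close> needs.\<close>
    have "set p \<subseteq> set c" using j by (subst pc) (auto intro!: nth_mem mod_less_divisor)
    then have "card (set p) \<le> card (set c)" by (intro card_mono) auto
    then have len: "2 * m \<le> length c" using p(2) m(2) card_length[of c] by (simp add: distinct_card)
    have rep: "?\<phi> (c ! ((j + i) mod length c)) = ?\<phi> (c ! ((j + m + i) mod length c))" if "i < m" for i
      using m(3)[OF that] nth[of i] nth[of "m + i"] that by (simp add: add.assoc)
    from c show False
    proof
      assume [simp]: "c = outer_cycle n"
      obtain i where "i < m" "f ((j + i) mod (2 * n)) \<noteq> f ((j + m + i) mod (2 * n))"
        using cyc[OF m(1), of j] len by auto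
      with rep[of i] n show False by (simp add: position_outer_cycle)
    next
      assume "\<exists>i \<in> {1..<n}. c = quadrangle i"
      then obtain i where i: "1 \<le> i" "i < n" and c: "c = quadrangle i" by auto
      define col where "col k = ?\<phi> (c ! k)" for k
      have col: "col 0 = f (i - 1)" "col 1 = f (2 * n - i)" "col 2 = f (2 * n - i - 1)" "col 3 = f i"
        by (simp_all add: col_def c quadrangle_def position_def)
      \<comment> \<open>The horizontal sides are edges of the outer cycle, i.e. the case
        \<open>m = 1\<close> of \<open>cyc\<close>; the rungs and the diagonal come from
        \<open>E\<close>.\<close>
      have "f (i - 1) \<noteq> f i"
        using cyc[of 1 "i - 1"] i by simp
      moreover have "f (2 * n - i - 1) \<noteq> f (2 * n - i)"
        using cyc[of 1 "2 * n - i - 1"] i by (simp add: Suc_diff_Suc)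
      moreover have "f (i - 1) \<noteq> f (2 * n - i)" "f i \<noteq> f (2 * n - i - 1)" "f i \<noteq> f (2 * n - i)"
        using i E[of "i - 1" "2 * n - i"] E[of i "2 * n - i - 1"] E[of i "2 * n - i"] by auto
      ultimately have ne: "col 0 \<noteq> col 1" "col 1 \<noteq> col 2" "col 2 \<noteq> col 3" "col 3 \<noteq> col 0" "col 1 \<noteq> col 3"
        unfolding col by auto
      have [simp]: "length c = 4" by (simp add: c quadrangle_def)
      have rep: "col ((j + i) mod 4) = col ((j + m + i) mod 4)" if "i < m" for i
        using rep[OF that] by (simp add: col_def)
      have "m = 1 \<or> m = 2" "j = 0 \<or> j = 1 \<or> j = 2 \<or> j = 3" using len m(1) j by auto
      moreover have "col (j mod 4) = col ((j + m) mod 4)" using rep[of 0] m(1) by simp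
      \<comment> \<open>For \<open>m = 2\<close> this equation and the previous one concern the two
        diagonals, so one of them contradicts \<open>col 1 \<noteq> col 3\<close>.\<close>
      moreover have "col ((j + 1) mod 4) = col ((j + 3) mod 4)" if "m = 2"
        using rep[of 1] that by (simp add: add.commute)
      ultimately show False using ne by (auto simp del: One_nat_def)
    qed
  qed
  show ?thesis
    unfolding facial_nonrepetitive_def
  proof (intro allI impI)
    fix p assume p: "facial_path (ladder n) (ladder_rotation n) p"
    then consider "boundary_segment (ladder n) (ladder_rotation n) p"
      | "boundary_segment (ladder n) (ladder_rotation n) (rev p)" | x where "p = [x]"
      by (auto simp: facial_path_def)
    then show "\<not> repetition (map ?\<phi> p)"
    proof cases
      case 1
      then show ?thesis using segment p by (simp add: facial_path_def)
    next
      case 2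
      then have "\<not> repetition (map ?\<phi> (rev p))" using segment[of "rev p"] p by (simp add: facial_path_def)
      then show ?thesis by (simp add: rev_map[symmetric] del: comp_apply)
    next
      case 3
      then show ?thesis by (auto simp: repetition_def)
    qed
  qed
qed

lemma facial_choosable_ladder:
  assumes n: "n \<ge> 1"
  shows "facial_choosable (ladder n) (ladder_rotation n) 8"
  unfolding facial_choosable_def
proof (intro allI impI)
  fix L :: "nat \<times> nat \<Rightarrow> nat set"
  assume L: "\<forall>x \<in> pverts (ladder n). L x \<subseteq> {1..} \<and> (infinite (L x) \<or> 8 \<le> card (L x))"
  have vert: "outer_cycle n ! p \<in> pverts (ladder n)" if "p < 2 * n" for p
    using that by (auto simp: nth_outer_cycle ladder_pverts)
  \<comment> \<open>Counting requires finite lists, so infinite ones are first cut down to finite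
    sublists.\<close>
  have "\<exists>K \<subseteq> L x. finite K \<and> 8 \<le> card K" if "x \<in> pverts (ladder n)" for x
  proof (cases "finite (L x)")
    case False
    then show ?thesis using infinite_arbitrarily_large[of "L x" 8] by auto
  qed (use L that in auto)
  then have "\<forall>p. \<exists>K. p < 2 * n \<longrightarrow> K \<subseteq> L (outer_cycle n ! p) \<and> finite K \<and> 8 \<le> card K"
    using vert by meson
  then obtain K where K: "\<And>p. p < 2 * n \<Longrightarrow> K p \<subseteq> L (outer_cycle n ! p) \<and> finite (K p) \<and> 8 \<le> card (K p)"
    by metis
  \<comment> \<open>Sum \<open>2n - 1\<close> means a rung, sum \<open>2n\<close> a diagonal joining \<^term>\<open>uu i\<close> and \<^term>\<open>vv (i + 1)\<close>.\<close>
  define E where "E p q \<longleftrightarrow> p \<noteq> q \<and> p + q \<in> {2 * n - 1, 2 * n}" for p q :: nat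
  interpret cyclic_colouring "2 * n" K E
  proof
    fix p assume "p < 2 * n"
    \<comment> \<open>Each of the two admissible sums leaves one possible partner for
      \<open>p\<close>.\<close>
    have "card {q. q < 2 * n \<and> E p q} \<le> card {2 * n - 1 - p, 2 * n - p}"
      by (intro card_mono) (auto simp: E_def)
    also have "\<dots> \<le> 2" by (simp add: card_insert_if)
    finally show "card {q. q < 2 * n \<and> E p q} \<le> 2" .
  qed (use n K in \<open>auto simp: E_def add.commute\<close>)
  obtain f where f: "\<And>p. p < 2 * n \<Longrightarrow> f p \<in> K p"
    "\<And>p q. p < 2 * n \<Longrightarrow> q < 2 * n \<Longrightarrow> E p q \<Longrightarrow> f p \<noteq> f q"
    "\<And>j m. 1 \<le> m \<Longrightarrow> 2 * m \<le> 2 * n \<Longrightarrow>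
      \<exists>i < m. f ((j + i) mod (2 * n)) \<noteq> f ((j + m + i) mod (2 * n))"
    using ex_colouring by blast
  have "facial_nonrepetitive (ladder n) (ladder_rotation n) (f \<circ> position n)"
    using f(2) by (intro facial_nonrepetitive_ladder n f(3)) (auto simp: E_def)
  moreover have "(f \<circ> position n) x \<in> L x" if "x \<in> pverts (ladder n)" for x
  proof -
    have "position n x < 2 * n" "outer_cycle n ! position n x = x"
      using that by (auto simp: position_def ladder_pverts nth_outer_cycle)
    then show ?thesis using f(1)[of "position n x"] K[of "position n x"] by auto
  qed
  ultimately show "\<exists>\<phi>. facial_nonrepetitive (ladder n) (ladder_rotation n) \<phi> \<and>
      (\<forall>x \<in> pverts (ladder n). \<phi> x \<in> L x)"
    by blast
qed

theorem theorem9: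
  fixes n :: nat
  assumes "n \<ge> 1"
  shows "facial_thue_choice_number (ladder n) (ladder_rotation n) \<le> 8"
proof -
  have "facial_thue_choice_number (ladder n) (ladder_rotation n) \<le> enat 8"
    unfolding facial_thue_choice_number_def using facial_choosable_ladder[OF assms]
    by (intro INF_lower) simp
  then show ?thesis by (simp add: numeral_eq_enat)
qed

end
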